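(* Let $\alpha \in [0,1]$ and $H \in (0,1)$. The weighted tensorized fractional Brownian field $\{X^{\alpha,H}_{(x_1,x_2)}\}_{(x_1,x_2)\in\mathbb{R}^2}$ has stationary rectangular increments; that is, for any $(y_1,y_2)\in\mathbb{R}^2$, $$\{\Delta X^{\alpha,H}_{(x_1,x_2);(y_1,y_2)}\}_{(x_1,x_2)\in\mathbb{R}^2}\stackrel{(d)}{=}\{X^{\alpha,H}_{(x_1,x_2)}\}_{(x_1,x_2)\in\mathbb{R}^2}.$$
   Context: For $\alpha\in[0,1]$ and $H\in(0,1)$ set $H_\alpha^+ := (1+\alpha)H$ and $H_\alpha^- := (1-\alpha)H$, and $$\phi_{\alpha,H}(\xi_1,\xi_2) := \min(|\xi_1|,|\xi_2|)^{H_\alpha^-+\frac12}\,\max(|\xi_1|,|\xi_2|)^{H_\alpha^++\frac12}.$$ The weighted tensorized fractional Brownian field $X^{\alpha,H}$ is the Gaussian field $$X^{\alpha,H}_{(x_1,x_2)} := \int_{\mathbb{R}^2} \mathcal{K}^{\alpha,H}_{(x_1,x_2)}(\xi_1,\xi_2)\, d\hat{\mathbf{W}}(\boldsymbol{\xi}), \qquad \mathcal{K}^{\alpha,H}_{(x_1,x_2)}(\xi_1,\xi_2) := \frac{(e^{i x_1\xi_1}-1)(e^{i x_2\xi_2}-1)}{\phi_{\alpha,H}(\xi_1,\xi_2)}.$$ For each $(x_1,x_2)$ the kernel belongs to $L^2(\mathbb{R}^2)$. Here $d\hat{\mathbf{W}}$ is the Fourier transform of real Gaussian white noise on $\mathbb{R}^2$: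 the map $f\mapsto\int f\,d\hat{\mathbf{W}}$ is linear, satisfies the isometry $\mathbb{E}\left[\int f\,d\hat{\mathbf{W}}\;\overline{\int g\,d\hat{\mathbf{W}}}\right]=\int_{\mathbb{R}^2} f\,\overline{g}\,d\boldsymbol{\xi}$, and yields jointly Gaussian, centered, real-valued variables for those $f\in L^2(\mathbb{R}^2)$ with $f(-\boldsymbol{\xi})=\overline{f(\boldsymbol{\xi})}$ (as is the case for the kernels above). Equivalently, $X^{\alpha,H}$ is a centered real Gaussian field with covariance $\mathbb{E}[X^{\alpha,H}_{x}X^{\alpha,H}_{y}]=\int_{\mathbb{R}^2}\mathcal{K}^{\alpha,H}_{x}(\boldsymbol{\xi})\,\overline{\mathcal{K}^{\alpha,H}_{y}(\boldsymbol{\xi})}\,d\boldsymbol{\xi}$. For a field $\{X_{(x_1,x_2)}\}_{(x_1,x_2)\in\mathbb{R}^2}$ and $(x_1,x_2),(y_1,y_2)\in\mathbb{R}^2$, the rectangular increment is $$\Delta X_{(x_1,x_2);(y_1,y_2)} := X_{(x_1+y_1,x_2+y_2)}-X_{(y_1,x_2+y_2)}-X_{(x_1+y_1,y_2)}+X_{(y_1,y_2)}.$$ The symbol $\stackrel{(d)}{=}$ denotes equality of all finite-dimensional distributions. *)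

theory Defs
  imports "HOL-Probability.Probability"
begin

section \<open>Random fields\<close>

text \<open>The point mass at \<open>0\<close> counts as a centered Gaussian law; \<^const>\<open>normal_density\<close> covers
  only positive standard deviations.\<close>

definition centered_gaussian :: "'w measure \<Rightarrow> ('w \<Rightarrow> real) \<Rightarrow> bool" where
  "centered_gaussian M Z \<longleftrightarrow>
     Z \<in> borel_measurable M \<and>
     ((AE \<omega> in M. Z \<omega> = 0) \<or> (\<exists>\<sigma>>0. distributed M lborel Z (normal_density 0 \<sigma>)))"

definition jointly_centered_gaussian :: "'w measure \<Rightarrow> 'i set \<Rightarrow> ('i \<Rightarrow> 'w \<Rightarrow> real) \<Rightarrow> bool" where
  "jointly_centered_gaussian M I Z \<longleftrightarrow>
     (\<forall>J c. finite J \<and> J \<subseteq> I \<longrightarrow> centered_gaussian M (\<lambda>\<omega>. \<Sum>i\<in>J. c i * Z i \<omega>))"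

definition eq_fdd ::
    "'v measure \<Rightarrow> ('t \<Rightarrow> 'v \<Rightarrow> real) \<Rightarrow> 'w measure \<Rightarrow> ('t \<Rightarrow> 'w \<Rightarrow> real) \<Rightarrow> bool" where
  "eq_fdd M X N Y \<longleftrightarrow>
     (\<forall>t. X t \<in> borel_measurable M) \<and> (\<forall>t. Y t \<in> borel_measurable N) \<and>
     (\<forall>J. finite J \<longrightarrow>
        distr M (Pi\<^sub>M J (\<lambda>_. borel)) (\<lambda>\<omega>. \<lambda>t\<in>J. X t \<omega>) =
        distr N (Pi\<^sub>M J (\<lambda>_. borel)) (\<lambda>\<omega>. \<lambda>t\<in>J. Y t \<omega>))"

definition rect_increment ::
    "(real \<times> real \<Rightarrow> 'w \<Rightarrow> real) \<Rightarrow> real \<times> real \<Rightarrow> real \<times> real \<Rightarrow> 'w \<Rightarrow> real" where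
  "rect_increment X = (\<lambda>(x1, x2) (y1, y2) \<omega>.
     X (x1 + y1, x2 + y2) \<omega> - X (y1, x2 + y2) \<omega> - X (x1 + y1, y2) \<omega> + X (y1, y2) \<omega>)"

definition stationary_rect_increments ::
    "'w measure \<Rightarrow> (real \<times> real \<Rightarrow> 'w \<Rightarrow> real) \<Rightarrow> bool" where
  "stationary_rect_increments M X \<longleftrightarrow> (\<forall>y. eq_fdd M (\<lambda>x. rect_increment X x y) M X)"

section \<open>The Fourier transform of real Gaussian white noise on the plane\<close>

definition L2_plane :: "(real \<times> real \<Rightarrow> complex) set" where
  "L2_plane = {f. f \<in> borel_measurable lborel \<and> integrable lborel (\<lambda>\<xi>. (cmod (f \<xi>))\<^sup>2)}"

definition hermitian_L2_plane :: "(real \<times> real \<Rightarrow> complex) set" where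
  "hermitian_L2_plane = {f \<in> L2_plane. \<forall>\<xi>. f (- \<xi>) = cnj (f \<xi>)}"

text \<open>\<open>W f\<close> stands for the stochastic integral of \<open>f\<close>. It is constrained only for square-integrable
  \<open>f\<close>, and its defining identities between random variables hold almost surely. Invariance under
  changing \<open>f\<close> on a null set follows from linearity and the isometry.\<close>

locale fourier_white_noise = prob_space M
  for M :: "'w measure" and W :: "(real \<times> real \<Rightarrow> complex) \<Rightarrow> 'w \<Rightarrow> complex" +
  assumes W_measurable: "f \<in> L2_plane \<Longrightarrow> W f \<in> borel_measurable M"
    and W_square_integrable: "f \<in> L2_plane \<Longrightarrow> integrable M (\<lambda>\<omega>. (cmod (W f \<omega>))\<^sup>2)"
    and W_linear: "f \<in> L2_plane \<Longrightarrow> g \<in> L2_plane \<Longrightarrow>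
      AE \<omega> in M. W (\<lambda>\<xi>. a * f \<xi> + b * g \<xi>) \<omega> = a * W f \<omega> + b * W g \<omega>"
    and W_isometry: "f \<in> L2_plane \<Longrightarrow> g \<in> L2_plane \<Longrightarrow>
      (\<integral>\<omega>. W f \<omega> * cnj (W g \<omega>) \<partial>M) = (\<integral>\<xi>. f \<xi> * cnj (g \<xi>) \<partial>lborel)"
    and W_real: "f \<in> hermitian_L2_plane \<Longrightarrow> AE \<omega> in M. W f \<omega> \<in> \<real>"
    and W_gaussian: "jointly_centered_gaussian M hermitian_L2_plane (\<lambda>f \<omega>. Re (W f \<omega>))"

section \<open>The weighted tensorized fractional Brownian field\<close>

definition H_plus :: "real \<Rightarrow> real \<Rightarrow> real" where
  "H_plus \<alpha> H = (1 + \<alpha>) * H"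

definition H_minus :: "real \<Rightarrow> real \<Rightarrow> real" where
  "H_minus \<alpha> H = (1 - \<alpha>) * H"

definition wtfbf_phi :: "real \<Rightarrow> real \<Rightarrow> real \<times> real \<Rightarrow> real" where
  "wtfbf_phi \<alpha> H = (\<lambda>(\<xi>1, \<xi>2).
     min \<bar>\<xi>1\<bar> \<bar>\<xi>2\<bar> powr (H_minus \<alpha> H + 1/2) * max \<bar>\<xi>1\<bar> \<bar>\<xi>2\<bar> powr (H_plus \<alpha> H + 1/2))"

text \<open>On the axes, a null set, the quotient is \<open>0\<close> by the convention for division by zero.\<close>

definition wtfbf_kernel :: "real \<Rightarrow> real \<Rightarrow> real \<times> real \<Rightarrow> real \<times> real \<Rightarrow> complex" where
  "wtfbf_kernel \<alpha> H = (\<lambda>(x1, x2) (\<xi>1, \<xi>2).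
     (exp (\<i> * of_real (x1 * \<xi>1)) - 1) * (exp (\<i> * of_real (x2 * \<xi>2)) - 1)
       / of_real (wtfbf_phi \<alpha> H (\<xi>1, \<xi>2)))"

text \<open>The kernels are Hermitian, so their stochastic integrals are almost surely real; taking the
  real part only selects a real-valued version.\<close>

definition wtfbf ::
    "((real \<times> real \<Rightarrow> complex) \<Rightarrow> 'w \<Rightarrow> complex) \<Rightarrow> real \<Rightarrow> real \<Rightarrow> real \<times> real \<Rightarrow> 'w \<Rightarrow> real" where
  "wtfbf W \<alpha> H x \<omega> = Re (W (wtfbf_kernel \<alpha> H x) \<omega>)"

end

theory Submission
  imports Defs
begin

text \<open>In frequency space the rectangular increment based at \<open>y\<close> multiplies every kernel by the same
  unimodular factor \<open>exp (\<i> y \<bullet> \<xi>)\<close>. A finite linear combination of increments and the corresponding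
  combination of values of the field are therefore centered Gaussian variables with equal variance,
  hence with equal characteristic function. Characteristic functions of all linear combinations
  determine the finite-dimensional distributions.\<close>

text \<open>Two features of the white noise integral shape the argument. \<open>W\<close> is
  constrained only on \<open>L2_plane\<close>, so square-integrability of the kernels has to be
  established before any of its laws applies. Its identities hold only almost surely, outside a null
  set that depends on the functions involved, so increments and stochastic integrals are compared
  under expectations and never pointwise. Gaussianity is assumed for Hermitian integrands. Hence the
  coefficients of the linear combinations are real, and it matters that the unimodular factor takes
  conjugate values at opposite frequencies: a product of factor and kernel is in general not a
  kernel of the field, yet it stays in the class on which \<open>W\<close> is real and Gaussian. The
  passage to joint laws rests on one-dimensional Levy uniqueness under reweighted measures. The
  weights that arise are complex, whereas a density must be non-negative; the shifted weight
  \<open>1 + Re G\<close> bridges this gap.\<close>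

section \<open>From characteristic functions to finite-dimensional laws\<close>

text \<open>Divided by its total mass, a non-negative weight is a probability density, and the
  hypothesis says that \<open>U\<close> and \<open>V\<close> have the same characteristic function
  under the reweighted measures. Levy uniqueness then identifies their laws.\<close>

lemma integral_weight_indicator_eq_of_char_eq_nonneg:
  fixes U :: "'a \<Rightarrow> real" and V :: "'b \<Rightarrow> real" and G :: "'a \<Rightarrow> real" and G' :: "'b \<Rightarrow> real"
  assumes "prob_space M" "prob_space N"
    and [measurable]: "U \<in> borel_measurable M" "V \<in> borel_measurable N"
    and [measurable]: "G \<in> borel_measurable M" "G' \<in> borel_measurable N"
    and G: "\<And>x. 0 \<le> G x" "\<And>x. G x \<le> C" and G': "\<And>x. 0 \<le> G' x" "\<And>x. G' x \<le> C"
    and eq: "\<And>s. (CLINT x|M. G x * iexp (s * U x)) = (CLINT x|N. G' x * iexp (s * V x))"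
    and [measurable]: "A \<in> sets borel"
  shows "(LINT x|M. G x * indicator A (U x)) = (LINT x|N. G' x * indicator A (V x))"
proof -
  interpret M: prob_space M by fact
  interpret N: prob_space N by fact
  define c where "c = (LINT x|M. G x)"
  have intG: "integrable M G"
    by (rule M.integrable_const_bound[of _ C]) (use G in auto)
  have intG': "integrable N G'"
    by (rule N.integrable_const_bound[of _ C]) (use G' in auto)
  \<comment> \<open>Frequency \<open>0\<close> shows that both weights have the same mass, so one
    constant normalises both.\<close>
  have "complex_of_real c = complex_of_real (LINT x|N. G' x)"
    using eq[of 0] by (simp add: c_def)
  then have c': "c = (LINT x|N. G' x)" by (simp only: of_real_eq_iff)
  show ?thesis
  proof (cases "c = 0")
    \<comment> \<open>With mass zero there is nothing to normalise, but then both weights vanish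
      almost everywhere.\<close>
    case True
    then have "AE x in M. G x = 0" "AE x in N. G' x = 0"
      using integral_nonneg_eq_0_iff_AE[OF intG] integral_nonneg_eq_0_iff_AE[OF intG'] G G' c' c_def
      by auto
    then have "(LINT x|M. G x * indicator A (U x)) = 0" "(LINT x|N. G' x * indicator A (V x)) = 0"
      by (auto intro!: integral_eq_zero_AE elim!: eventually_mono)
    then show ?thesis by simp
  next
    case False
    then have c: "c > 0" using G unfolding c_def by (simp add: order_less_le)
    define D where "D = distr (density M (\<lambda>x. G x / c)) borel U"
    define E where "E = distr (density N (\<lambda>x. G' x / c)) borel V"
    have "prob_space (density M (\<lambda>x. G x / c))"
      by (rule prob_spaceI)
        (use c G intG in \<open>auto simp: emeasure_density nn_integral_eq_integral c_def[symmetric]\<close>)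
    then have D: "real_distribution D"
      unfolding D_def by (auto intro!: real_distribution.intro prob_space.prob_space_distr
          simp: real_distribution_axioms_def)
    have "prob_space (density N (\<lambda>x. G' x / c))"
      by (rule prob_spaceI)
        (use c G' intG' in \<open>auto simp: emeasure_density nn_integral_eq_integral c'[symmetric]\<close>)
    then have E: "real_distribution E"
      unfolding E_def by (auto intro!: real_distribution.intro prob_space.prob_space_distr
          simp: real_distribution_axioms_def)
    have "char D = char E"
    proof
      fix s
      have "char D s = (CLINT x|M. (G x * iexp (s * U x)) / c)"
        unfolding D_def char_def using c G
        by (simp add: integral_distr integral_density scaleR_conv_of_real)
      also have "\<dots> = (CLINT x|N. (G' x * iexp (s * V x)) / c)"
        using eq[of s] by (simp del: of_real_mult)
      also have "\<dots> = char E s"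
        unfolding E_def char_def using c G'
        by (simp add: integral_distr integral_density scaleR_conv_of_real)
      finally show "char D s = char E s" .
    qed
    then have "D = E" by (rule Levy_uniqueness[OF D E])
    then have "(LINT x|D. indicator A x) = (LINT x|E. indicator A x :: real)" by simp
    moreover have "(LINT x|D. indicator A x) = (LINT x|M. G x * indicator A (U x)) / c"
      unfolding D_def using c G
      by (subst integral_distr, simp_all del: Bochner_Integration.integral_indicator)
        (subst integral_density, simp_all)
    moreover have "(LINT x|E. indicator A x) = (LINT x|N. G' x * indicator A (V x)) / c"
      unfolding E_def using c G'
      by (subst integral_distr, simp_all del: Bochner_Integration.integral_indicator)
        (subst integral_density, simp_all)
    ultimately show ?thesis using c by simp
  qed
qed

lemma (in prob_space) integrable_bounded_mult_iexp:
  fixes G :: "'a \<Rightarrow> complex"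
  assumes [measurable]: "G \<in> borel_measurable M" "U \<in> borel_measurable M"
    and "\<And>x. norm (G x) \<le> 1"
  shows "integrable M (\<lambda>x. G x * iexp (U x))"
  by (rule integrable_const_bound[of _ 1]) (use assms in \<open>auto simp: norm_mult\<close>)

text \<open>Since \<open>Re G\<close> is half of \<open>G\<close> plus its conjugate, and
  conjugation reverses the frequency, the transform of the non-negative weight
  \<open>1 + Re G\<close> is determined by the transforms of \<open>1\<close> and
  \<open>G\<close>.\<close>

lemma (in prob_space) integral_one_plus_Re_weight:
  fixes G :: "'a \<Rightarrow> complex"
  assumes [measurable]: "G \<in> borel_measurable M" "U \<in> borel_measurable M"
    and G: "\<And>x. norm (G x) \<le> 1"
  shows "(CLINT x|M. of_real (1 + Re (G x)) * iexp (s * U x)) =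
    (CLINT x|M. iexp (s * U x)) +
    ((CLINT x|M. G x * iexp (s * U x)) + cnj (CLINT x|M. G x * iexp (- s * U x))) / 2"
proof -
  have eq: "of_real (1 + Re (G x)) * iexp (s * U x) =
    iexp (s * U x) + (G x * iexp (s * U x) + cnj (G x * iexp (- s * U x))) / 2" for x
  proof -
    have "complex_of_real (Re (G x)) = (G x + cnj (G x)) / 2"
      by (simp add: complex_add_cnj)
    moreover have "cnj (iexp (- s * U x)) = iexp (s * U x)"
      by (simp add: exp_cnj)
    ultimately show ?thesis by (simp add: algebra_simps add_divide_distrib)
  qed
  have int1: "integrable M (\<lambda>x. iexp (s * U x))"
    using integrable_bounded_mult_iexp[of "\<lambda>_. 1" "\<lambda>x. s * U x"] by simp
  have intG: "integrable M (\<lambda>x. G x * iexp (s * U x))" for s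
    by (rule integrable_bounded_mult_iexp) (use G in auto)
  have intC: "integrable M (\<lambda>x. cnj (G x * iexp (- s * U x)))"
    by (rule integrable_cnj) (rule intG)
  show ?thesis
    unfolding eq Bochner_Integration.integral_add[OF int1
        integrable_divide_zero[OF Bochner_Integration.integrable_add[OF intG intC]]]
      integral_divide_zero Bochner_Integration.integral_add[OF intG intC]
      Bochner_Integration.integral_cnj ..
qed

text \<open>Real and imaginary parts are treated separately. Adding \<open>1\<close> makes each a
  weight with values between \<open>0\<close> and \<open>2\<close>, and the contribution of the
  added constant is subtracted afterwards.\<close>

lemma integral_weight_indicator_eq_of_char_eq:
  fixes U :: "'a \<Rightarrow> real" and V :: "'b \<Rightarrow> real"
    and G :: "'a \<Rightarrow> complex" and G' :: "'b \<Rightarrow> complex"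
  assumes M: "prob_space M" and N: "prob_space N"
    and [measurable]: "U \<in> borel_measurable M" "V \<in> borel_measurable N"
    and [measurable]: "G \<in> borel_measurable M" "G' \<in> borel_measurable N"
    and G: "\<And>x. norm (G x) \<le> 1" and G': "\<And>x. norm (G' x) \<le> 1"
    and char: "\<And>s. (CLINT x|M. iexp (s * U x)) = (CLINT x|N. iexp (s * V x))"
    and eq: "\<And>s. (CLINT x|M. G x * iexp (s * U x)) = (CLINT x|N. G' x * iexp (s * V x))"
    and [measurable]: "A \<in> sets borel"
  shows "(CLINT x|M. G x * indicator A (U x)) = (CLINT x|N. G' x * indicator A (V x))"
proof -
  interpret M: prob_space M by fact
  interpret N: prob_space N by fact
  have ind: "(LINT x|M. 1 * indicator A (U x)) = (LINT x|N. 1 * indicator A (V x) :: real)"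
    by (rule integral_weight_indicator_eq_of_char_eq_nonneg[OF M N, of U V _ _ 1]) (use char in auto)
  \<comment> \<open>Stated for arbitrary weights because it serves twice: for \<open>G\<close>, and
    for \<open>- \<i> * G\<close>, whose real part is \<open>Im G\<close>.\<close>
  have Re: "(LINT x|M. Re (F x) * indicator A (U x)) = (LINT x|N. Re (F' x) * indicator A (V x))"
    if [measurable]: "F \<in> borel_measurable M" "F' \<in> borel_measurable N"
      and F: "\<And>x. norm (F x) \<le> 1" and F': "\<And>x. norm (F' x) \<le> 1"
      and eqF: "\<And>s. (CLINT x|M. F x * iexp (s * U x)) = (CLINT x|N. F' x * iexp (s * V x))"
    for F F'
  proof -
    have ReF: "\<bar>Re (F x)\<bar> \<le> 1" "\<bar>Re (F' y)\<bar> \<le> 1" for x y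
      using F[of x] F'[of y] abs_Re_le_cmod order_trans by blast+
    have "(LINT x|M. (1 + Re (F x)) * indicator A (U x)) = (LINT x|N. (1 + Re (F' x)) * indicator A (V x))"
    proof (rule integral_weight_indicator_eq_of_char_eq_nonneg[OF M N, of U V _ _ 2])
      fix s
      show "(CLINT x|M. of_real (1 + Re (F x)) * iexp (s * U x)) =
        (CLINT x|N. of_real (1 + Re (F' x)) * iexp (s * V x))"
        using F F' by (simp only: M.integral_one_plus_Re_weight N.integral_one_plus_Re_weight eqF char
            \<open>F \<in> borel_measurable M\<close> \<open>F' \<in> borel_measurable N\<close>
            \<open>U \<in> borel_measurable M\<close> \<open>V \<in> borel_measurable N\<close>)
    qed (use ReF in \<open>auto simp: abs_le_iff minus_le_iff\<close>, (smt (verit) ReF)+)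
    moreover have "integrable M (\<lambda>x. Re (F x) * indicator A (U x))"
      by (rule M.integrable_const_bound[of _ 1]) (use ReF in \<open>auto simp: indicator_def\<close>)
    moreover have "integrable N (\<lambda>x. Re (F' x) * indicator A (V x))"
      by (rule N.integrable_const_bound[of _ 1]) (use ReF in \<open>auto simp: indicator_def\<close>)
    moreover have "integrable M (\<lambda>x. indicator A (U x) :: real)"
      by (rule M.integrable_const_bound[of _ 1]) (auto simp: indicator_def)
    moreover have "integrable N (\<lambda>x. indicator A (V x) :: real)"
      by (rule N.integrable_const_bound[of _ 1]) (auto simp: indicator_def)
    ultimately show ?thesis using ind by (simp add: distrib_right)
  qed
  have int: "integrable M (\<lambda>x. G x * indicator A (U x))"
    by (rule M.integrable_const_bound[of _ 1]) (use G in \<open>auto simp: indicator_def\<close>)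
  have int': "integrable N (\<lambda>x. G' x * indicator A (V x))"
    by (rule N.integrable_const_bound[of _ 1]) (use G' in \<open>auto simp: indicator_def\<close>)
  have ind_mult: "Re (z * indicator A u) = Re z * indicator A u"
    "Im (z * indicator A u) = Im z * indicator A u" for z u
    by (auto simp: indicator_def)
  have "(LINT x|M. Re (G x) * indicator A (U x)) = (LINT x|N. Re (G' x) * indicator A (V x))"
    by (rule Re) (use G G' eq in auto)
  moreover have "(LINT x|M. Re (- \<i> * G x) * indicator A (U x)) =
      (LINT x|N. Re (- \<i> * G' x) * indicator A (V x))"
  proof (rule Re)
    fix s
    show "(CLINT x|M. - \<i> * G x * iexp (s * U x)) = (CLINT x|N. - \<i> * G' x * iexp (s * V x))"
      using eq[of s] by (simp add: mult.assoc)
  qed (use G G' in \<open>auto simp: norm_mult\<close>)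
  then have "(LINT x|M. Im (G x) * indicator A (U x)) = (LINT x|N. Im (G' x) * indicator A (V x))"
    by simp
  ultimately show ?thesis
    unfolding complex_eq_iff
    by (simp only: integral_Re[OF int, symmetric] integral_Re[OF int', symmetric]
        integral_Im[OF int, symmetric] integral_Im[OF int', symmetric] ind_mult)
qed

text \<open>Indicators are inserted one coordinate at a time: the remaining exponentials and the indicators
  already present act as a complex weight for the one-dimensional uniqueness theorem.\<close>

lemma distr_PiM_eq_of_char_eq:
  fixes X :: "'i \<Rightarrow> 'a \<Rightarrow> real" and Y :: "'i \<Rightarrow> 'b \<Rightarrow> real"
  assumes M: "prob_space M" and N: "prob_space N" and J: "finite J"
    and X[measurable]: "\<And>j. j \<in> J \<Longrightarrow> X j \<in> borel_measurable M"
    and Y[measurable]: "\<And>j. j \<in> J \<Longrightarrow> Y j \<in> borel_measurable N"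
    and char: "\<And>t. (CLINT x|M. iexp (\<Sum>j\<in>J. t j * X j x)) = (CLINT x|N. iexp (\<Sum>j\<in>J. t j * Y j x))"
  shows "distr M (Pi\<^sub>M J (\<lambda>_. borel)) (\<lambda>x. \<lambda>j\<in>J. X j x) =
    distr N (Pi\<^sub>M J (\<lambda>_. borel)) (\<lambda>x. \<lambda>j\<in>J. Y j x)"
proof -
  interpret M: prob_space M by fact
  interpret N: prob_space N by fact
  have mX: "(\<lambda>x. \<lambda>j\<in>J. X j x) \<in> measurable M (Pi\<^sub>M J (\<lambda>_. borel))"
    by (rule measurable_restrict) auto
  have mY: "(\<lambda>x. \<lambda>j\<in>J. Y j x) \<in> measurable N (Pi\<^sub>M J (\<lambda>_. borel))"
    by (rule measurable_restrict) auto
  have shift: "(\<Sum>j\<in>J. (t(k := t k + s)) j * Z j) = (\<Sum>j\<in>J. t j * Z j) + s * Z k"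
    if "k \<in> J" for t Z k and s :: real
    using J that by (simp add: sum.remove[of J k] algebra_simps)
  \<comment> \<open>The frequency vector \<open>t\<close> stays arbitrary in the induction: testing
    the weight against \<open>iexp (s * X k x)\<close> amounts to the induction hypothesis with
    \<open>t k\<close> raised by \<open>s\<close>.\<close>
  have step: "(CLINT x|M. (\<Prod>k\<in>K. indicator (A k) (X k x)) * iexp (\<Sum>j\<in>J. t j * X j x)) =
      (CLINT x|N. (\<Prod>k\<in>K. indicator (A k) (Y k x)) * iexp (\<Sum>j\<in>J. t j * Y j x))"
    if "finite K" "K \<subseteq> J" and A: "\<And>k. k \<in> J \<Longrightarrow> A k \<in> sets borel" for K t A
    using that(1,2)
  proof (induction K arbitrary: t)
    case empty
    then show ?case using char by simp
  next
    case (insert k K)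
    then have k: "k \<in> J" and KJ: "\<And>j. j \<in> K \<Longrightarrow> j \<in> J" by auto
    note [measurable] = X[OF k] Y[OF k] X[OF KJ] Y[OF KJ] A[OF k] A[OF KJ]
    let ?G = "\<lambda>x. (\<Prod>k\<in>K. indicator (A k) (X k x)) * iexp (\<Sum>j\<in>J. t j * X j x)"
    let ?G' = "\<lambda>x. (\<Prod>k\<in>K. indicator (A k) (Y k x)) * iexp (\<Sum>j\<in>J. t j * Y j x)"
    have bound: "norm (\<Prod>k\<in>K. indicator (A k) (Z k) :: complex) \<le> 1" for Z :: "'i \<Rightarrow> real"
      unfolding prod_norm[symmetric] by (intro prod_le_1) (auto simp: indicator_def)
    have "(CLINT x|M. ?G x * indicator (A k) (X k x)) = (CLINT x|N. ?G' x * indicator (A k) (Y k x))"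
    proof (rule integral_weight_indicator_eq_of_char_eq[OF M N])
      fix s
      show "(CLINT x|M. iexp (s * X k x)) = (CLINT x|N. iexp (s * Y k x))"
        \<comment> \<open>The form \<open>0 + s\<close> makes this vector the instance of
          \<open>shift\<close> at the zero vector, which isolates the marginal of coordinate
          \<open>k\<close>.\<close>
        using char[of "(\<lambda>_. 0)(k := 0 + s)"] unfolding shift[OF k, of "\<lambda>_. 0" s] by simp
      show "(CLINT x|M. ?G x * iexp (s * X k x)) = (CLINT x|N. ?G' x * iexp (s * Y k x))"
        using insert.IH[of "t(k := t k + s)"] insert.prems
        by (simp only: shift[OF k, of t] of_real_add distrib_left exp_add mult.assoc insert_subset)
    qed (use bound in \<open>auto simp: norm_mult simp del: of_real_sum of_real_mult\<close>)
    then show ?case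
      using insert.hyps by (simp add: mult_ac del: of_real_sum of_real_mult)
  qed
  have prodind: "(\<Prod>k\<in>J. indicator (A k) (Z k)) =
      complex_of_real (indicator (Pi\<^sub>E J A) (\<lambda>j\<in>J. Z j))" for A and Z :: "'i \<Rightarrow> real"
  proof (cases "\<forall>k\<in>J. Z k \<in> A k")
    case False
    then obtain k where "k \<in> J" "Z k \<notin> A k" by auto
    then have "(\<Prod>k\<in>J. indicator (A k) (Z k)) = (0 :: complex)" "(\<lambda>j\<in>J. Z j) \<notin> Pi\<^sub>E J A"
      using J by (auto intro!: prod_zero bexI[of _ k] simp: PiE_iff)
    then show ?thesis by simp
  qed (auto simp: PiE_iff)
  show ?thesis
  proof (rule measure_eqI_PiM_finite[OF J])
    fix A assume A: "\<And>i. i \<in> J \<Longrightarrow> A i \<in> sets (borel :: real measure)"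
    have S[measurable]: "Pi\<^sub>E J A \<in> sets (Pi\<^sub>M J (\<lambda>_. borel))"
      using J A by (intro sets_PiM_I_finite) auto
    note [measurable] = mX mY
    have "(LINT x|M. indicator (Pi\<^sub>E J A) (\<lambda>j\<in>J. X j x)) =
        (LINT x|N. indicator (Pi\<^sub>E J A) (\<lambda>j\<in>J. Y j x) :: real)"
      using step[OF J subset_refl, of A "\<lambda>_. 0"] A by (simp add: prodind)
    then have "(LINT x|distr M (Pi\<^sub>M J (\<lambda>_. borel)) (\<lambda>x. \<lambda>j\<in>J. X j x). indicator (Pi\<^sub>E J A) x) =
        (LINT x|distr N (Pi\<^sub>M J (\<lambda>_. borel)) (\<lambda>x. \<lambda>j\<in>J. Y j x). indicator (Pi\<^sub>E J A) x :: real)"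
      by (subst (1 2) integral_distr) auto
    then have "measure (distr M (Pi\<^sub>M J (\<lambda>_. borel)) (\<lambda>x. \<lambda>j\<in>J. X j x)) (Pi\<^sub>E J A) =
        measure (distr N (Pi\<^sub>M J (\<lambda>_. borel)) (\<lambda>x. \<lambda>j\<in>J. Y j x)) (Pi\<^sub>E J A)"
      using S sets.sets_into_space[OF S] by (simp add: Int_absorb2)
    moreover have "prob_space (distr M (Pi\<^sub>M J (\<lambda>_. borel)) (\<lambda>x. \<lambda>j\<in>J. X j x))"
      "prob_space (distr N (Pi\<^sub>M J (\<lambda>_. borel)) (\<lambda>x. \<lambda>j\<in>J. Y j x))"
      by (auto intro: M.prob_space_distr N.prob_space_distr mX mY)
    ultimately show "emeasure (distr M (Pi\<^sub>M J (\<lambda>_. borel)) (\<lambda>x. \<lambda>j\<in>J. X j x)) (Pi\<^sub>E J A) =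
        emeasure (distr N (Pi\<^sub>M J (\<lambda>_. borel)) (\<lambda>x. \<lambda>j\<in>J. Y j x)) (Pi\<^sub>E J A)"
      by (simp add: finite_measure.emeasure_eq_measure prob_space_def)
  next
    show "range (\<lambda>_::nat. space (Pi\<^sub>M J (\<lambda>_. borel :: real measure))) \<subseteq> prod_algebra J (\<lambda>_. borel)"
      using J by (auto simp: space_PiM intro!: prod_algebraI_finite)
    show "emeasure (distr M (Pi\<^sub>M J (\<lambda>_. borel)) (\<lambda>x. \<lambda>j\<in>J. X j x)) (space (Pi\<^sub>M J (\<lambda>_. borel))) \<noteq> \<infinity>"
      using M.prob_space_distr[OF mX]
      by (simp add: prob_space_def finite_measure.emeasure_finite)
  qed auto
qed

section \<open>Centered Gaussian laws\<close>

lemma (in prob_space) normal_distributed_second_moment: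
  assumes "\<sigma> > 0" "distributed M lborel Z (normal_density 0 \<sigma>)"
  shows "(LINT x|M. (Z x)\<^sup>2) = \<sigma>\<^sup>2"
  using normal_distributed_variance[OF assms] normal_distributed_expectation[OF assms] by simp

lemma (in prob_space) AE_zero_second_moment_char:
  assumes [measurable]: "Z \<in> borel_measurable M" and Z: "AE x in M. Z x = 0"
  shows "(LINT x|M. (Z x)\<^sup>2) = 0" "(CLINT x|M. iexp (Z x)) = 1"
proof -
  show "(LINT x|M. (Z x)\<^sup>2) = 0"
    by (rule integral_eq_zero_AE) (use Z in \<open>auto elim: eventually_mono\<close>)
  have "(CLINT x|M. iexp (Z x)) = (CLINT x|M. 1)"
    by (rule integral_cong_AE) (use Z in \<open>auto elim: eventually_mono\<close>)
  then show "(CLINT x|M. iexp (Z x)) = 1" by (simp add: prob_space)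
qed

text \<open>The variance determines the law. It also decides between the point mass and a normal
  density, since it is positive exactly in the second case, so the mixed cases are
  contradictory.\<close>

lemma centered_gaussian_char_eq:
  assumes "prob_space M" "prob_space N"
    and Z: "centered_gaussian M Z" and Y: "centered_gaussian N Y"
    and eq: "(LINT x|M. (Z x)\<^sup>2) = (LINT x|N. (Y x)\<^sup>2)"
  shows "(CLINT x|M. iexp (Z x)) = (CLINT x|N. iexp (Y x))"
proof -
  interpret M: prob_space M by fact
  interpret N: prob_space N by fact
  have [measurable]: "Z \<in> borel_measurable M" "Y \<in> borel_measurable N"
    using Z Y by (auto simp: centered_gaussian_def)
  consider "AE x in M. Z x = 0" | \<sigma> where "\<sigma> > 0" "distributed M lborel Z (normal_density 0 \<sigma>)"
    using Z by (auto simp: centered_gaussian_def)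
  note cZ = this
  consider "AE x in N. Y x = 0" | \<sigma> where "\<sigma> > 0" "distributed N lborel Y (normal_density 0 \<sigma>)"
    using Y by (auto simp: centered_gaussian_def)
  note cY = this
  note Z0 = M.AE_zero_second_moment_char[of Z] and Y0 = N.AE_zero_second_moment_char[of Y]
  show ?thesis
  proof (cases rule: cZ)
    case 1
    then show ?thesis
      using Z0 Y0 eq by (cases rule: cY) (auto simp: N.normal_distributed_second_moment)
  next
    case (2 \<sigma>)
    then have nz: "(LINT x|M. (Z x)\<^sup>2) = \<sigma>\<^sup>2" "\<sigma>\<^sup>2 \<noteq> 0"
      by (auto simp: M.normal_distributed_second_moment)
    then have "\<not> (AE x in N. Y x = 0)" using eq Y0(1) by auto
    with cY obtain \<tau> where \<tau>: "\<tau> > 0" "distributed N lborel Y (normal_density 0 \<tau>)"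
      by auto
    with nz eq have "\<tau>\<^sup>2 = \<sigma>\<^sup>2" by (simp add: N.normal_distributed_second_moment)
    then have "\<tau> = \<sigma>" using \<tau> 2 by simp
    then have "distr M lborel Z = distr N lborel Y"
      using \<tau> 2 by (simp add: distributed_distr_eq_density)
    then have "(CLINT x|distr M lborel Z. iexp x) = (CLINT x|distr N lborel Y. iexp x)"
      by simp
    then show ?thesis
      by (simp add: integral_distr)
  qed
qed

section \<open>Square-integrability of the kernels\<close>

text \<open>The modulus is twice \<open>\<bar>sin (x * \<xi> / 2)\<bar>\<close>. The constant bound
  serves large frequencies, the quadratic one small frequencies.\<close>

lemma norm_iexp_minus_1_sq_le: "(cmod (iexp (x * \<xi>) - 1))\<^sup>2 \<le> min 4 (x\<^sup>2 * \<xi>\<^sup>2)"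
proof -
  have "cmod (iexp (x * \<xi>) - 1) \<le> 2 * 1"
    unfolding dist_exp_i_1 by (intro mult_left_mono) auto
  moreover have "cmod (iexp (x * \<xi>) - 1) \<le> 2 * \<bar>x * \<xi> / 2\<bar>"
    unfolding dist_exp_i_1 by (intro mult_left_mono abs_sin_x_le_abs_x) auto
  then have "cmod (iexp (x * \<xi>) - 1) \<le> \<bar>x * \<xi>\<bar>"
    by (simp del: of_real_mult)
  ultimately have "(cmod (iexp (x * \<xi>) - 1))\<^sup>2 \<le> (2 * 1)\<^sup>2"
    "(cmod (iexp (x * \<xi>) - 1))\<^sup>2 \<le> \<bar>x * \<xi>\<bar>\<^sup>2"
    by (blast intro: power_mono norm_ge_zero)+
  then show ?thesis by (simp add: power_mult_distrib del: of_real_mult)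
qed

lemma integrable_powr_near_0:
  assumes "-1 < (a::real)"
  shows "integrable lborel (\<lambda>x. indicator {0..1} x * x powr a)"
proof -
  have "(\<lambda>x. x powr a) absolutely_integrable_on {0..1}"
    by (intro nonnegative_absolutely_integrable_1 integrable_on_powr_from_0) (use assms in auto)
  then show ?thesis by (simp add: set_integrable_def integrable_completion)
qed

lemma integrable_powr_at_infinity:
  assumes "(a::real) < -1"
  shows "integrable lborel (\<lambda>x. indicator {1..} x * x powr a)"
proof -
  have "(\<lambda>x. x powr a) absolutely_integrable_on {1..}"
    by (intro nonnegative_absolutely_integrable_1)
      (use has_integral_powr_to_inf[OF assms, of 1] in \<open>auto simp: integrable_on_def\<close>)
  then show ?thesis by (simp add: set_integrable_def integrable_completion)
qed

text \<open>This is, up to a constant, the spectral integrand for the variance of one-dimensional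
  fractional Brownian motion. Near \<open>0\<close> the exponent \<open>1 - 2 * H\<close> exceeds
  \<open>-1\<close> because \<open>H < 1\<close>; at infinity \<open>- (2 * H + 1)\<close> is below
  \<open>-1\<close> because \<open>H > 0\<close>.\<close>

lemma integrable_fbm_spectral:
  fixes x H :: real
  assumes H: "0 < H" "H < 1"
  shows "integrable lborel (\<lambda>\<xi>. (cmod (iexp (x * \<xi>) - 1))\<^sup>2 / \<bar>\<xi>\<bar> powr (2 * H + 1))"
proof -
  define g where "g \<xi> = x\<^sup>2 * (indicator {0..1} \<xi> * \<xi> powr (1 - 2 * H)) +
    4 * (indicator {1..} \<xi> * \<xi> powr (- (2 * H + 1)))" for \<xi> :: real
  have g: "integrable lborel g"
    unfolding g_def using integrable_powr_near_0[of "1 - 2 * H"]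
      integrable_powr_at_infinity[of "- (2 * H + 1)"] H by simp
  \<comment> \<open>\<open>g\<close> lives on the non-negative half-line; adding its reflection
    covers negative frequencies, where the integrand takes the same values.\<close>
  then have g2: "integrable lborel (\<lambda>\<xi>. g \<xi> + g (- \<xi>))"
    using lborel_integrable_real_affine[OF g, of "-1" 0] by simp
  have g_nonneg: "0 \<le> g \<xi>" for \<xi>
    unfolding g_def by auto
  have pos: "(cmod (iexp (x * \<xi>) - 1))\<^sup>2 / \<xi> powr (2 * H + 1) \<le> g \<xi>"
    if "\<xi> > 0" for \<xi>
  proof (cases "\<xi> \<le> 1")
    case True
    have "(cmod (iexp (x * \<xi>) - 1))\<^sup>2 / \<xi> powr (2 * H + 1) \<le> x\<^sup>2 * \<xi>\<^sup>2 / \<xi> powr (2 * H + 1)"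
      using norm_iexp_minus_1_sq_le[of x \<xi>] by (intro divide_right_mono) auto
    also have "\<dots> = x\<^sup>2 * \<xi> powr (1 - 2 * H)"
    proof -
      have "\<xi>\<^sup>2 = \<xi> powr 2" using that by simp
      moreover have "\<xi> powr 2 / \<xi> powr (2 * H + 1) = \<xi> powr (1 - 2 * H)"
        using powr_diff[of \<xi> 2 "2 * H + 1"] by simp
      ultimately show ?thesis by (simp only: times_divide_eq_right[symmetric])
    qed
    also have "\<dots> \<le> g \<xi>" using that True by (simp add: g_def)
    finally show ?thesis .
  next
    case False
    have "(cmod (iexp (x * \<xi>) - 1))\<^sup>2 / \<xi> powr (2 * H + 1) \<le> 4 / \<xi> powr (2 * H + 1)"
      using norm_iexp_minus_1_sq_le[of x \<xi>] by (intro divide_right_mono) auto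
    also have "\<dots> = 4 * \<xi> powr (- (2 * H + 1))" by (simp only: powr_minus divide_inverse)
    also have "\<dots> = g \<xi>" using that False by (simp add: g_def)
    finally show ?thesis .
  qed
  show ?thesis
  proof (rule Bochner_Integration.integrable_bound[OF g2])
    show "AE \<xi> in lborel. norm ((cmod (iexp (x * \<xi>) - 1))\<^sup>2 / \<bar>\<xi>\<bar> powr (2 * H + 1))
      \<le> norm (g \<xi> + g (- \<xi>))"
    proof (rule AE_I2)
      fix \<xi> :: real
      consider "\<xi> > 0" | "\<xi> = 0" | "\<xi> < 0" by linarith
      then have "(cmod (iexp (x * \<xi>) - 1))\<^sup>2 / \<bar>\<xi>\<bar> powr (2 * H + 1) \<le> g \<xi> + g (- \<xi>)"
      proof cases
        case 1
        then show ?thesis using pos[of \<xi>] g_nonneg[of "- \<xi>"] by simp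
      next
        case 2
        then show ?thesis using g_nonneg[of 0] by simp
      next
        case 3
        have "cmod (iexp (x * - \<xi>) - 1) = cmod (iexp (x * \<xi>) - 1)"
          unfolding dist_exp_i_1 by simp
        then show ?thesis using pos[of "- \<xi>"] g_nonneg[of "\<xi>"] 3 by simp
      qed
      then show "norm ((cmod (iexp (x * \<xi>) - 1))\<^sup>2 / \<bar>\<xi>\<bar> powr (2 * H + 1)) \<le> norm (g \<xi> + g (- \<xi>))"
        using g_nonneg by simp
    qed
  qed simp
qed

lemma integrable_lborel_tensor:
  fixes f g :: "real \<Rightarrow> real"
  assumes f: "integrable lborel f" and g: "integrable lborel g"
  shows "integrable lborel (\<lambda>(x, y). f x * g y)"
proof -
  have [measurable]: "f \<in> borel_measurable borel" "g \<in> borel_measurable borel"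
    using f g by (auto dest: borel_measurable_integrable)
  have "integrable (lborel \<Otimes>\<^sub>M lborel) (\<lambda>(x, y). f x * g y)"
    by (rule lborel_pair.Fubini_integrable) (use f g in \<open>auto simp: abs_mult\<close>)
  then show ?thesis by (simp add: lborel_prod)
qed

text \<open>Since \<open>min \<le> max\<close>, moving the exponent \<open>\<alpha> H\<close> from the maximum to the minimum only decreases
  the weight, which reduces square-integrability to the tensorized case \<open>\<alpha> = 0\<close>.\<close>

lemma wtfbf_phi_sq_ge:
  assumes "0 \<le> \<alpha>" "0 < H"
  shows "\<bar>\<xi>1\<bar> powr (2 * H + 1) * \<bar>\<xi>2\<bar> powr (2 * H + 1) \<le> (wtfbf_phi \<alpha> H (\<xi>1, \<xi>2))\<^sup>2"
proof -
  define a b where "a = min \<bar>\<xi>1\<bar> \<bar>\<xi>2\<bar>" and "b = max \<bar>\<xi>1\<bar> \<bar>\<xi>2\<bar>"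
  have ab: "0 \<le> a" "a \<le> b" by (auto simp: a_def b_def)
  have "\<bar>\<xi>1\<bar> powr (2 * H + 1) * \<bar>\<xi>2\<bar> powr (2 * H + 1) = a powr (2 * H + 1) * b powr (2 * H + 1)"
    by (auto simp: a_def b_def min_def max_def mult.commute)
  \<comment> \<open>On the axes both sides are \<open>0\<close>, since \<open>0 powr p = 0\<close>;
    the exponent laws are used for positive bases only.\<close>
  also have "\<dots> \<le> (a powr (H_minus \<alpha> H + 1/2) * b powr (H_plus \<alpha> H + 1/2))\<^sup>2"
  proof (cases "a = 0")
    case False
    then have a: "a > 0" "b > 0" using ab by auto
    have sq: "(u powr p)\<^sup>2 = u powr (2 * p)" if "u > 0" for u p :: real
      using that by (simp add: power2_eq_square flip: powr_add)
    have "a powr (2 * H + 1) * b powr (2 * H + 1) =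
      a powr (2 * H_minus \<alpha> H + 1) * a powr (2 * \<alpha> * H) * b powr (2 * H + 1)"
      by (simp add: H_minus_def algebra_simps flip: powr_add)
    also have "\<dots> \<le> a powr (2 * H_minus \<alpha> H + 1) * b powr (2 * \<alpha> * H) * b powr (2 * H + 1)"
      using ab a assms by (intro mult_right_mono mult_left_mono powr_mono2) auto
    also have "\<dots> = a powr (2 * H_minus \<alpha> H + 1) * b powr (2 * H_plus \<alpha> H + 1)"
      by (simp add: H_plus_def algebra_simps flip: powr_add)
    also have "\<dots> = (a powr (H_minus \<alpha> H + 1/2) * b powr (H_plus \<alpha> H + 1/2))\<^sup>2"
      using a by (simp add: power_mult_distrib sq algebra_simps)
    finally show ?thesis .
  qed simp
  also have "\<dots> = (wtfbf_phi \<alpha> H (\<xi>1, \<xi>2))\<^sup>2"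
    by (simp add: wtfbf_phi_def a_def b_def)
  finally show ?thesis .
qed

lemma wtfbf_kernel_measurable [measurable]: "wtfbf_kernel \<alpha> H x \<in> borel_measurable borel"
proof -
  have "wtfbf_kernel \<alpha> H x \<in> borel_measurable (borel \<Otimes>\<^sub>M borel)"
    unfolding wtfbf_kernel_def wtfbf_phi_def case_prod_beta by measurable
  then show ?thesis by (simp add: borel_prod)
qed

text \<open>The lower bound on \<open>wtfbf_phi\<close> dominates the squared kernel by a product of
  two one-dimensional spectral integrands.\<close>

lemma wtfbf_kernel_in_L2_plane:
  assumes "0 \<le> \<alpha>" "0 < H" "H < 1"
  shows "wtfbf_kernel \<alpha> H x \<in> L2_plane"
proof -
  obtain x1 x2 where x: "x = (x1, x2)" by (cases x)
  let ?f = "\<lambda>x \<xi>. (cmod (iexp (x * \<xi>) - 1))\<^sup>2 / \<bar>\<xi>\<bar> powr (2 * H + 1)"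
  have "integrable lborel (\<lambda>(\<xi>1, \<xi>2). ?f x1 \<xi>1 * ?f x2 \<xi>2)"
    by (intro integrable_lborel_tensor integrable_fbm_spectral assms)
  then have "integrable lborel (\<lambda>\<xi>. (cmod (wtfbf_kernel \<alpha> H x \<xi>))\<^sup>2)"
  proof (rule Bochner_Integration.integrable_bound)
    show "AE \<xi> in lborel. norm ((cmod (wtfbf_kernel \<alpha> H x \<xi>))\<^sup>2)
      \<le> norm (case \<xi> of (\<xi>1, \<xi>2) \<Rightarrow> ?f x1 \<xi>1 * ?f x2 \<xi>2)"
    proof (rule AE_I2)
      fix \<xi> :: "real \<times> real"
      obtain \<xi>1 \<xi>2 where \<xi>: "\<xi> = (\<xi>1, \<xi>2)" by (cases \<xi>)
      let ?n = "(cmod (iexp (x1 * \<xi>1) - 1))\<^sup>2 * (cmod (iexp (x2 * \<xi>2) - 1))\<^sup>2"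
      have "(cmod (wtfbf_kernel \<alpha> H x \<xi>))\<^sup>2 = ?n / (wtfbf_phi \<alpha> H (\<xi>1, \<xi>2))\<^sup>2"
        by (simp add: wtfbf_kernel_def x \<xi> norm_mult norm_divide power_mult_distrib power_divide
            del: of_real_mult)
      also have "\<dots> \<le> ?n / (\<bar>\<xi>1\<bar> powr (2 * H + 1) * \<bar>\<xi>2\<bar> powr (2 * H + 1))"
      \<comment> \<open>Off the axes both denominators are positive, as the monotonicity of division
        demands; on the axes the numerator vanishes.\<close>
      proof (cases "\<xi>1 = 0 \<or> \<xi>2 = 0")
        case False
        then show ?thesis
          using assms by (intro divide_left_mono mult_pos_pos wtfbf_phi_sq_ge zero_less_power2[THEN iffD2])
            (auto simp: wtfbf_phi_def min_def max_def)
      qed auto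
      also have "\<dots> = ?f x1 \<xi>1 * ?f x2 \<xi>2" by simp
      finally show "norm ((cmod (wtfbf_kernel \<alpha> H x \<xi>))\<^sup>2)
          \<le> norm (case \<xi> of (\<xi>1, \<xi>2) \<Rightarrow> ?f x1 \<xi>1 * ?f x2 \<xi>2)"
        by (simp add: \<xi> del: of_real_mult)
    qed
  qed simp
  then show ?thesis by (simp add: L2_plane_def)
qed

section \<open>Linear combinations and laws of white noise integrals\<close>

lemma L2_plane_linear:
  assumes f: "f \<in> L2_plane" and g: "g \<in> L2_plane"
  shows "(\<lambda>\<xi>. a * f \<xi> + b * g \<xi>) \<in> L2_plane"
proof -
  have [measurable]: "f \<in> borel_measurable borel" "g \<in> borel_measurable borel"
    using f g by (auto simp: L2_plane_def)
  \<comment> \<open>The factors \<open>2\<close> come from bounding the square of a sum by twice the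
    sum of the squares.\<close>
  have "integrable lborel (\<lambda>\<xi>. 2 * (cmod a)\<^sup>2 * (cmod (f \<xi>))\<^sup>2 + 2 * (cmod b)\<^sup>2 * (cmod (g \<xi>))\<^sup>2)"
    using f g by (auto simp: L2_plane_def)
  then have "integrable lborel (\<lambda>\<xi>. (cmod (a * f \<xi> + b * g \<xi>))\<^sup>2)"
  proof (rule Bochner_Integration.integrable_bound)
    have "(cmod (a * f \<xi> + b * g \<xi>))\<^sup>2 \<le> 2 * (cmod a)\<^sup>2 * (cmod (f \<xi>))\<^sup>2 + 2 * (cmod b)\<^sup>2 * (cmod (g \<xi>))\<^sup>2"
      for \<xi>
    proof -
      have "(cmod (a * f \<xi> + b * g \<xi>))\<^sup>2 \<le> (cmod (a * f \<xi>) + cmod (b * g \<xi>))\<^sup>2"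
        by (intro power_mono norm_triangle_ineq) auto
      also have "\<dots> \<le> 2 * (cmod (a * f \<xi>))\<^sup>2 + 2 * (cmod (b * g \<xi>))\<^sup>2"
        by (smt (verit) sum_squares_bound power2_sum)
      finally show ?thesis by (simp add: norm_mult power_mult_distrib)
    qed
    then show "AE \<xi> in lborel. norm ((cmod (a * f \<xi> + b * g \<xi>))\<^sup>2) \<le>
        norm (2 * (cmod a)\<^sup>2 * (cmod (f \<xi>))\<^sup>2 + 2 * (cmod b)\<^sup>2 * (cmod (g \<xi>))\<^sup>2)"
      by simp
  qed simp
  then show ?thesis by (simp add: L2_plane_def)
qed

lemma L2_plane_zero: "(\<lambda>\<xi>. 0) \<in> L2_plane"
  by (simp add: L2_plane_def)

lemma L2_plane_sum:
  assumes "finite J" "\<And>j. j \<in> J \<Longrightarrow> f j \<in> L2_plane"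
  shows "(\<lambda>\<xi>. \<Sum>j\<in>J. c j * f j \<xi>) \<in> L2_plane"
  using assms
proof (induction J)
  case (insert j J)
  then show ?case using L2_plane_linear[of "f j" "\<lambda>\<xi>. \<Sum>j\<in>J. c j * f j \<xi>" "c j" 1] by simp
qed (simp add: L2_plane_zero)

context fourier_white_noise
begin

lemma W_zero: "AE \<omega> in M. W (\<lambda>\<xi>. 0) \<omega> = 0"
  using W_linear[OF L2_plane_zero L2_plane_zero, of 0 0] by simp

lemma W_sum:
  assumes "finite J" "\<And>j. j \<in> J \<Longrightarrow> f j \<in> L2_plane"
  shows "AE \<omega> in M. W (\<lambda>\<xi>. \<Sum>j\<in>J. c j * f j \<xi>) \<omega> = (\<Sum>j\<in>J. c j * W (f j) \<omega>)"
  using assms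
proof (induction J)
  case empty
  then show ?case using W_zero by simp
next
  case (insert j J)
  then have "AE \<omega> in M. W (\<lambda>\<xi>. \<Sum>j\<in>J. c j * f j \<xi>) \<omega> = (\<Sum>j\<in>J. c j * W (f j) \<omega>)" by simp
  moreover have "AE \<omega> in M. W (\<lambda>\<xi>. c j * f j \<xi> + 1 * (\<Sum>j\<in>J. c j * f j \<xi>)) \<omega> =
      c j * W (f j) \<omega> + 1 * W (\<lambda>\<xi>. \<Sum>j\<in>J. c j * f j \<xi>) \<omega>"
    using insert by (intro W_linear L2_plane_sum) auto
  ultimately show ?case
    by eventually_elim (simp add: insert.hyps)
qed

lemma centered_gaussian_Re_W:
  assumes "f \<in> hermitian_L2_plane"
  shows "centered_gaussian M (\<lambda>\<omega>. Re (W f \<omega>))"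
proof -
  have "centered_gaussian M (\<lambda>\<omega>. \<Sum>i\<in>{f}. (\<lambda>_. 1) i * Re (W i \<omega>))"
    by (rule W_gaussian[unfolded jointly_centered_gaussian_def, rule_format]) (use assms in simp)
  then show ?thesis by simp
qed

text \<open>The isometry yields the second moment of the modulus of \<open>W f\<close>; almost sure
  reality turns it into that of the real part.\<close>

lemma second_moment_Re_W:
  assumes f: "f \<in> hermitian_L2_plane"
  shows "(LINT \<omega>|M. (Re (W f \<omega>))\<^sup>2) = (LINT \<xi>|lborel. (cmod (f \<xi>))\<^sup>2)"
proof -
  have L2: "f \<in> L2_plane" using f by (simp add: hermitian_L2_plane_def)
  note [measurable] = W_measurable[OF L2]
  have "(LINT \<omega>|M. (Re (W f \<omega>))\<^sup>2) = (LINT \<omega>|M. (cmod (W f \<omega>))\<^sup>2)"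
    by (rule integral_cong_AE) (use W_real[OF f] in \<open>auto elim!: eventually_mono simp: complex_is_Real_iff cmod_power2\<close>)
  moreover have "z * cnj z = of_real ((cmod z)\<^sup>2)" for z
    by (simp add: complex_norm_square del: of_real_power)
  then have "complex_of_real (LINT \<omega>|M. (cmod (W f \<omega>))\<^sup>2) = of_real (LINT \<xi>|lborel. (cmod (f \<xi>))\<^sup>2)"
    using W_isometry[OF L2 L2] by (simp only: integral_complex_of_real)
  ultimately show ?thesis by (simp only: of_real_eq_iff)
qed

lemma char_Re_W_eq:
  assumes "f \<in> hermitian_L2_plane" "g \<in> hermitian_L2_plane" "\<And>\<xi>. cmod (f \<xi>) = cmod (g \<xi>)"
  shows "(CLINT \<omega>|M. iexp (Re (W f \<omega>))) = (CLINT \<omega>|M. iexp (Re (W g \<omega>)))"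
  using assms by (intro centered_gaussian_char_eq centered_gaussian_Re_W prob_space_axioms)
    (simp_all add: second_moment_Re_W)

end

section \<open>Plane waves and the increment identity\<close>

text \<open>The character of the plane by which a translation by \<open>y\<close> acts in frequency
  space.\<close>

definition plane_wave :: "real \<times> real \<Rightarrow> real \<times> real \<Rightarrow> complex" where
  "plane_wave y \<xi> = iexp (fst y * fst \<xi> + snd y * snd \<xi>)"

lemma plane_wave_measurable [measurable]: "plane_wave y \<in> borel_measurable borel"
proof -
  have "plane_wave y \<in> borel_measurable (borel \<Otimes>\<^sub>M borel)"
    unfolding plane_wave_def by measurable
  then show ?thesis by (simp add: borel_prod)
qed

lemma norm_plane_wave [simp]: "cmod (plane_wave y \<xi>) = 1"
  unfolding plane_wave_def by (simp del: of_real_add of_real_mult)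

lemma plane_wave_uminus: "plane_wave y (- \<xi>) = cnj (plane_wave y \<xi>)"
  by (simp add: plane_wave_def exp_cnj algebra_simps)

lemma plane_wave_mult_L2_plane:
  "f \<in> L2_plane \<Longrightarrow> (\<lambda>\<xi>. plane_wave y \<xi> * f \<xi>) \<in> L2_plane"
  by (auto simp: L2_plane_def norm_mult)

lemma plane_wave_mult_hermitian:
  "f \<in> hermitian_L2_plane \<Longrightarrow> (\<lambda>\<xi>. plane_wave y \<xi> * f \<xi>) \<in> hermitian_L2_plane"
  by (simp add: hermitian_L2_plane_def plane_wave_mult_L2_plane plane_wave_uminus
      del: split_paired_All)

lemma wtfbf_kernel_uminus: "wtfbf_kernel \<alpha> H x (- \<xi>) = cnj (wtfbf_kernel \<alpha> H x \<xi>)"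
  by (simp add: wtfbf_kernel_def wtfbf_phi_def case_prod_beta exp_cnj)

text \<open>The numerator is a product over the coordinates and the denominator does not depend on
  the position. In each coordinate the difference cancels the \<open>- 1\<close> and leaves an
  exponential in \<open>y\<close> as a common factor.\<close>

lemma wtfbf_kernel_increment:
  "wtfbf_kernel \<alpha> H (x1 + y1, x2 + y2) \<xi> - wtfbf_kernel \<alpha> H (y1, x2 + y2) \<xi>
    - wtfbf_kernel \<alpha> H (x1 + y1, y2) \<xi> + wtfbf_kernel \<alpha> H (y1, y2) \<xi> =
   plane_wave (y1, y2) \<xi> * wtfbf_kernel \<alpha> H (x1, x2) \<xi>"
proof -
  obtain \<xi>1 \<xi>2 where \<xi>: "\<xi> = (\<xi>1, \<xi>2)" by (cases \<xi>)
  have add: "iexp ((x + y) * z) = iexp (x * z) * iexp (y * z)" for x y z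
    by (simp add: algebra_simps flip: exp_add)
  have wave: "plane_wave (y1, y2) \<xi> = iexp (y1 * \<xi>1) * iexp (y2 * \<xi>2)"
    by (simp add: plane_wave_def \<xi> algebra_simps flip: exp_add)
  \<comment> \<open>Here \<open>a\<close>, \<open>c\<close> are the exponentials of
    \<open>x1\<close>, \<open>x2\<close>, and \<open>b\<close>, \<open>d\<close> those of
    \<open>y1\<close>, \<open>y2\<close>. Also \<open>p = 0\<close> is covered, so the identity
    holds on the axes too.\<close>
  have "((a * b - 1) * (c * d - 1) / p - (b - 1) * (c * d - 1) / p - (a * b - 1) * (d - 1) / p
      + (b - 1) * (d - 1) / p) = b * d * ((a - 1) * (c - 1) / p)" for a b c d p :: complex
    by (simp add: algebra_simps flip: add_divide_distrib diff_divide_distrib)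
  then show ?thesis
    unfolding wave by (simp only: wtfbf_kernel_def \<xi> case_prod_conv add)
qed

section \<open>Stationarity of the rectangular increments\<close>

theorem proposition3p3:
  fixes \<alpha> H :: real
    and M :: "'w measure"
    and W :: "(real \<times> real \<Rightarrow> complex) \<Rightarrow> 'w \<Rightarrow> complex"
  assumes "0 \<le> \<alpha>" "\<alpha> \<le> 1"
    and "0 < H" "H < 1"
    and "fourier_white_noise M W"
  shows "stationary_rect_increments M (wtfbf W \<alpha> H)"
  unfolding stationary_rect_increments_def
proof
  fix y :: "real \<times> real"
  interpret fourier_white_noise M W by fact
  let ?K = "wtfbf_kernel \<alpha> H"
  have L2: "?K x \<in> L2_plane" for x
    by (rule wtfbf_kernel_in_L2_plane) fact+
  have mW: "wtfbf W \<alpha> H x \<in> borel_measurable M" for x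
    using W_measurable[OF L2[of x]] unfolding wtfbf_def by measurable
  have mD: "rect_increment (wtfbf W \<alpha> H) x y \<in> borel_measurable M" for x
    unfolding rect_increment_def case_prod_beta using mW by measurable
  have increment: "AE \<omega> in M. rect_increment (wtfbf W \<alpha> H) x y \<omega> =
      Re (W (\<lambda>\<xi>. plane_wave y \<xi> * ?K x \<xi>) \<omega>)" for x
  proof -
    obtain x1 x2 y1 y2 where xy: "x = (x1, x2)" "y = (y1, y2)" by (cases x, cases y)
    let ?a = "(x1 + y1, x2 + y2)" and ?b = "(y1, x2 + y2)" and ?c = "(x1 + y1, y2)" and ?d = "(y1, y2)"
    \<comment> \<open>Linearity of \<open>W\<close> handles two functions at a time, so the four
      corners are combined in pairs and the pairs are then added.\<close>
    have "AE \<omega> in M. W (\<lambda>\<xi>. 1 * ?K ?a \<xi> + (- 1) * ?K ?b \<xi>) \<omega> = 1 * W (?K ?a) \<omega> + (- 1) * W (?K ?b) \<omega>"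
      by (intro W_linear L2)
    moreover have "AE \<omega> in M. W (\<lambda>\<xi>. (- 1) * ?K ?c \<xi> + 1 * ?K ?d \<xi>) \<omega> = (- 1) * W (?K ?c) \<omega> + 1 * W (?K ?d) \<omega>"
      by (intro W_linear L2)
    moreover have "AE \<omega> in M. W (\<lambda>\<xi>. 1 * (1 * ?K ?a \<xi> + (- 1) * ?K ?b \<xi>) + 1 * ((- 1) * ?K ?c \<xi> + 1 * ?K ?d \<xi>)) \<omega> =
      1 * W (\<lambda>\<xi>. 1 * ?K ?a \<xi> + (- 1) * ?K ?b \<xi>) \<omega> + 1 * W (\<lambda>\<xi>. (- 1) * ?K ?c \<xi> + 1 * ?K ?d \<xi>) \<omega>"
      by (intro W_linear L2_plane_linear L2)
    moreover have "(\<lambda>\<xi>. 1 * (1 * ?K ?a \<xi> + (- 1) * ?K ?b \<xi>) + 1 * ((- 1) * ?K ?c \<xi> + 1 * ?K ?d \<xi>)) =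
      (\<lambda>\<xi>. plane_wave y \<xi> * ?K x \<xi>)"
      unfolding xy wtfbf_kernel_increment[symmetric] by (simp add: algebra_simps)
    ultimately show ?thesis
      by (auto elim!: eventually_elim2 simp: rect_increment_def xy wtfbf_def)
  qed
  show "eq_fdd M (\<lambda>x. rect_increment (wtfbf W \<alpha> H) x y) M (wtfbf W \<alpha> H)"
    unfolding eq_fdd_def
  proof (intro conjI allI impI)
    fix J :: "(real \<times> real) set"
    assume J: "finite J"
    show "distr M (Pi\<^sub>M J (\<lambda>_. borel)) (\<lambda>\<omega>. \<lambda>x\<in>J. rect_increment (wtfbf W \<alpha> H) x y \<omega>) =
      distr M (Pi\<^sub>M J (\<lambda>_. borel)) (\<lambda>\<omega>. \<lambda>x\<in>J. wtfbf W \<alpha> H x \<omega>)"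
    proof (rule distr_PiM_eq_of_char_eq[OF prob_space_axioms prob_space_axioms J mD mW])
      fix t :: "real \<times> real \<Rightarrow> real"
      \<comment> \<open>\<open>f\<close> and \<open>g\<close> are the integrands of the linear
        combinations of field values and of increments; they differ by the common wave, hence have
        equal modulus everywhere.\<close>
      define f where "f \<xi> = (\<Sum>x\<in>J. of_real (t x) * ?K x \<xi>)" for \<xi>
      define g where "g \<xi> = (\<Sum>x\<in>J. of_real (t x) * (plane_wave y \<xi> * ?K x \<xi>))" for \<xi>
      have g_eq: "g = (\<lambda>\<xi>. plane_wave y \<xi> * f \<xi>)"
        by (simp add: fun_eq_iff g_def f_def sum_distrib_left mult_ac)
      have f: "f \<in> hermitian_L2_plane"
        using L2_plane_sum[where f = ?K and c = "\<lambda>x. of_real (t x)", OF J L2]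
        by (simp add: hermitian_L2_plane_def f_def[abs_def] wtfbf_kernel_uminus
            del: split_paired_All)
      then have g: "g \<in> hermitian_L2_plane"
        unfolding g_eq by (rule plane_wave_mult_hermitian)
      have mf: "(\<lambda>\<omega>. Re (W f \<omega>)) \<in> borel_measurable M" "(\<lambda>\<omega>. Re (W g \<omega>)) \<in> borel_measurable M"
        using centered_gaussian_Re_W f g by (auto simp: centered_gaussian_def)
      note [measurable] = mf mW mD
      have "AE \<omega> in M. (\<Sum>x\<in>J. t x * wtfbf W \<alpha> H x \<omega>) = Re (W f \<omega>)"
        using W_sum[where f = ?K and c = "\<lambda>x. of_real (t x)", OF J L2]
        by eventually_elim (simp add: f_def[abs_def] wtfbf_def)
      then have X: "(CLINT \<omega>|M. iexp (\<Sum>x\<in>J. t x * wtfbf W \<alpha> H x \<omega>)) = (CLINT \<omega>|M. iexp (Re (W f \<omega>)))"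
        by (intro integral_cong_AE) (auto elim!: eventually_mono simp del: of_real_sum of_real_mult)
      \<comment> \<open>The exceptional null set depends on \<open>x\<close>; finiteness of
        \<open>J\<close> provides a common one.\<close>
      have "AE \<omega> in M. \<forall>x\<in>J. rect_increment (wtfbf W \<alpha> H) x y \<omega> = Re (W (\<lambda>\<xi>. plane_wave y \<xi> * ?K x \<xi>) \<omega>)"
        using J increment by (intro AE_finite_allI) auto
      moreover have "AE \<omega> in M. W g \<omega> = (\<Sum>x\<in>J. of_real (t x) * W (\<lambda>\<xi>. plane_wave y \<xi> * ?K x \<xi>) \<omega>)"
        unfolding g_def[abs_def] using L2 by (intro W_sum J plane_wave_mult_L2_plane)
      ultimately have "AE \<omega> in M. (\<Sum>x\<in>J. t x * rect_increment (wtfbf W \<alpha> H) x y \<omega>) = Re (W g \<omega>)"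
        by eventually_elim simp
      then have "(CLINT \<omega>|M. iexp (\<Sum>x\<in>J. t x * rect_increment (wtfbf W \<alpha> H) x y \<omega>)) = (CLINT \<omega>|M. iexp (Re (W g \<omega>)))"
        by (intro integral_cong_AE) (auto elim!: eventually_mono simp del: of_real_sum of_real_mult)
      then show "(CLINT \<omega>|M. iexp (\<Sum>x\<in>J. t x * rect_increment (wtfbf W \<alpha> H) x y \<omega>)) =
        (CLINT \<omega>|M. iexp (\<Sum>x\<in>J. t x * wtfbf W \<alpha> H x \<omega>))"
        unfolding X using char_Re_W_eq[OF g f] by (simp add: g_eq norm_mult)
    qed
  qed (fact mD mW)+
qed

end
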